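(* Let $C_0\ge20$ and let $\mathcal{P}_0$ be the set of all $(\alpha,\beta)\in D_0$ that have an infinite three-interval expansion $(n_k,m_k,\epsilon_{k+1})_{k\ge1}$ for which there exist $s\ge1$ and $k_{\alpha,\beta}\ge s$ such that $$(n_k+m_k)(n_{k-1}+m_{k-1})\cdots(n_{k-s+1}+m_{k-s+1})\ \ge\ (2C_0)^s\qquad\text{for all }k\ge k_{\alpha,\beta}.$$ Then the two-dimensional Lebesgue measure of $\mathcal{P}_0$ is zero.
   Context: Let $D_0=\{(\alpha,\beta):0<\alpha<1,\ 0<\beta<1-\alpha\}$. **Three-interval expansion.** Let $D=\{(x,y): x<\tfrac12,\ x+y<1,\ 2x+y>1\}$. Let $F(x,y)=\left(\frac{2x-1}{x},\frac yx\right)$ and $G(x,y)=(1-x-y,y)$. Given $(\alpha,\beta)\in D_0$, put $(\alpha^{(0)},\beta^{(0)})=(\alpha,\beta)$; given $(\alpha^{(k)},\beta^{(k)})$: if it lies in $D$, stop; if $\alpha^{(k)}>\frac12$, apply $F$; if $2\alpha^{(k)}+\beta^{(k)}<1$, apply $G$. If the procedure stops, let $(\bar\alpha,\bar\beta)\in D$ be the final point (it equals $(\alpha,\beta)$ if $(\alpha,\beta)\in D$). (The procedure stops unless $(\alpha,\beta)$ lies on one of countably many rational lines.) Put $x_0=\frac{1-\bar\alpha-\bar\beta}{1-\bar\alpha}$, $y_0=\frac{1-2\bar\alpha}{1-\bar\alpha}$ and, for $k\ge0$, let $$(u_k,v_k)=\begin{cases}\left(\frac{y_k}{x_k+y_k-1},\frac{x_k}{x_k+y_k-1}\right)&x_k+y_k>1,\\[2pt]\left(\frac{1-y_k}{1-(x_k+y_k)},\frac{1-x_k}{1-(x_k+y_k)}\right)&x_k+y_k<1,\end{cases}$$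 $(n_{k+1},m_{k+1})=([u_k],[v_k])$ (integer parts), $(x_{k+1},y_{k+1})=(\{u_k\},\{v_k\})$ (fractional parts), and $\epsilon_{k+1}=\operatorname{sgn}(x_k+y_k-1)$. The sequence $(n_k,m_k,\epsilon_{k+1})_{k\ge1}$ is the three-interval expansion of $(\alpha,\beta)$; it is infinite if all steps are defined (i.e. the first procedure stops and $x_k+y_k\ne1$ for all $k$). *)

theory Defs
  imports "HOL-Analysis.Analysis"
begin

definition D0 :: "(real \<times> real) set" where
  "D0 = {(\<alpha>, \<beta>). 0 < \<alpha> \<and> \<alpha> < 1 \<and> 0 < \<beta> \<and> \<beta> < 1 - \<alpha>}"

definition D :: "(real \<times> real) set" where
  "D = {(x, y). x < 1/2 \<and> x + y < 1 \<and> 2 * x + y > 1}"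

definition F :: "real \<times> real \<Rightarrow> real \<times> real" where
  "F = (\<lambda>(x, y). ((2 * x - 1) / x, y / x))"

definition G :: "real \<times> real \<Rightarrow> real \<times> real" where
  "G = (\<lambda>(x, y). (1 - x - y, y))"

text \<open>
  \<^term>\<open>stops_at p q\<close>: the preliminary procedure started at \<^term>\<open>p\<close> stops after finitely many
  steps, with final point \<^term>\<open>q\<close>.  On the lines \<open>\<alpha> = 1/2\<close> and \<open>2\<alpha> + \<beta> = 1\<close> no rule applies,
  so a run that meets one of them does not stop.  On \<^const>\<open>D0\<close>, which \<^const>\<open>F\<close> and \<^const>\<open>G\<close>
  preserve in the cases where they are applied, the three rules are mutually exclusive.
\<close>

inductive stops_at :: "real \<times> real \<Rightarrow> real \<times> real \<Rightarrow> bool" where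
  stop: "p \<in> D \<Longrightarrow> stops_at p p"
| apply_F: "\<alpha> > 1/2 \<Longrightarrow> stops_at (F (\<alpha>, \<beta>)) q \<Longrightarrow> stops_at (\<alpha>, \<beta>) q"
| apply_G: "2 * \<alpha> + \<beta> < 1 \<Longrightarrow> stops_at (G (\<alpha>, \<beta>)) q \<Longrightarrow> stops_at (\<alpha>, \<beta>) q"

lemma stops_at_unique:
  assumes "stops_at p q" "stops_at p q'" "p \<in> D0"
  shows "q = q'"
  using assms
proof (induction arbitrary: q' rule: stops_at.induct)
  case (stop p)
  from stop(2,1,3) show ?case
    by (cases rule: stops_at.cases) (auto simp: D_def D0_def)
next
  case (apply_F \<alpha> \<beta> q)
  have "F (\<alpha>, \<beta>) \<in> D0"
    using apply_F.hyps apply_F.prems by (auto simp: F_def D0_def field_simps)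
  moreover from apply_F.prems(1) have "stops_at (F (\<alpha>, \<beta>)) q'"
    using apply_F.hyps apply_F.prems(2) by (cases rule: stops_at.cases) (auto simp: D_def D0_def)
  ultimately show ?case using apply_F.IH by blast
next
  case (apply_G \<alpha> \<beta> q)
  have "G (\<alpha>, \<beta>) \<in> D0"
    using apply_G.hyps apply_G.prems by (auto simp: G_def D0_def)
  moreover from apply_G.prems(1) have "stops_at (G (\<alpha>, \<beta>)) q'"
    using apply_G.hyps apply_G.prems(2) by (cases rule: stops_at.cases) (auto simp: D_def D0_def)
  ultimately show ?case using apply_G.IH by blast
qed

text \<open>
  The map \<open>(x\<^sub>k, y\<^sub>k) \<mapsto> (u\<^sub>k, v\<^sub>k)\<close>.  Its value on the line \<open>x + y = 1\<close> is junk; that line is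
  excluded in \<open>infinite_expansion\<close> below.
\<close>

definition uv :: "real \<times> real \<Rightarrow> real \<times> real" where
  "uv = (\<lambda>(x, y).
     if x + y > 1 then (y / (x + y - 1), x / (x + y - 1))
     else ((1 - y) / (1 - (x + y)), (1 - x) / (1 - (x + y))))"

primrec xy :: "real \<times> real \<Rightarrow> nat \<Rightarrow> real \<times> real" where
  "xy q 0 = (case q of (\<alpha>, \<beta>) \<Rightarrow> ((1 - \<alpha> - \<beta>) / (1 - \<alpha>), (1 - 2 * \<alpha>) / (1 - \<alpha>)))"
| "xy q (Suc k) = (frac (fst (uv (xy q k))), frac (snd (uv (xy q k))))"

text \<open>
  The digits \<open>n\<^sub>k\<close>, \<open>m\<^sub>k\<close>, \<open>\<epsilon>\<^sub>k\<close> when the preliminary procedure ends in \<^term>\<open>q\<close>.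
  Only indices \<open>k \<ge> 1\<close> are meaningful.
\<close>

definition digit_n :: "real \<times> real \<Rightarrow> nat \<Rightarrow> int" where
  "digit_n q k = \<lfloor>fst (uv (xy q (k - 1)))\<rfloor>"

definition digit_m :: "real \<times> real \<Rightarrow> nat \<Rightarrow> int" where
  "digit_m q k = \<lfloor>snd (uv (xy q (k - 1)))\<rfloor>"

definition digit_eps :: "real \<times> real \<Rightarrow> nat \<Rightarrow> real" where
  "digit_eps q k = sgn (fst (xy q (k - 1)) + snd (xy q (k - 1)) - 1)"

text \<open>
  \<^term>\<open>p\<close> has the infinite three-interval expansion \<open>(n\<^sub>k, m\<^sub>k, \<epsilon>\<^sub>k\<^sub>+\<^sub>1)\<close>, \<open>k \<ge> 1\<close>; note the
  shifted index of \<open>\<epsilon>\<close>.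
\<close>

definition infinite_expansion ::
    "real \<times> real \<Rightarrow> (nat \<Rightarrow> int) \<Rightarrow> (nat \<Rightarrow> int) \<Rightarrow> (nat \<Rightarrow> real) \<Rightarrow> bool" where
  "infinite_expansion p n m \<epsilon> \<longleftrightarrow>
     (\<exists>q. stops_at p q \<and>
          (\<forall>k. fst (xy q k) + snd (xy q k) \<noteq> 1) \<and>
          (\<forall>k\<ge>1. n k = digit_n q k \<and> m k = digit_m q k \<and> \<epsilon> (k + 1) = digit_eps q (k + 1)))"

end

theory Submission
  imports Defs
begin

text \<open>
  The map \<open>T : (x\<^sub>k, y\<^sub>k) \<mapsto> (x\<^sub>k\<^sub>+\<^sub>1, y\<^sub>k\<^sub>+\<^sub>1)\<close> on the unit square has one full branch for every
  \<open>\<epsilon> = \<plusminus>1\<close> and \<open>n, m \<ge> 1\<close>.  The inverse branch is projective with Jacobian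
  \<open>(n + m - 1 + x + y)\<^sup>-\<^sup>3 \<le> (N - 1)\<^sup>-\<^sup>3\<close>, where \<open>N = n + m\<close>, and \<open>2 (N - 1)\<close> branches share the
  same \<open>N\<close>.  Weighting a digit by \<open>w(N) = (N/40)\<^bsup>2/3\<^esup>\<close>, one finds
  \<open>\<rho> = \<Sum> 2 w(N) / (N - 1)\<^sup>2 < 1\<close>, so a Markov inequality bounds the measure of the set on which the
  product of the first \<open>k\<close> weights is at least \<open>c\<close> by \<open>\<rho>\<^sup>k / c\<close>.  If every late window of length \<open>s\<close> has
  \<open>\<Prod>N \<ge> 40\<^sup>s\<close>, then the product of weights stays above a fixed \<open>c > 0\<close> along an arithmetic
  progression of \<open>k\<close>, which therefore happens only on a null set.  Each step
  of the preliminary procedure has a smooth inverse, hence pulls null sets back to null sets.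
\<close>


section \<open>Numerical estimate for the weighted series\<close>

definition weight :: "real \<Rightarrow> real" where
  "weight x = (root 3 (x / 40))\<^sup>2"

lemma weight_pos: "x > 0 \<Longrightarrow> weight x > 0"
  by (simp add: weight_def)

text \<open>Multiplicativity of the weight turns a lower bound on a product of digit sums into one
  on a product of weights.\<close>

lemma prod_weight: "(\<Prod>i\<in>I. weight (f i)) = (root 3 (\<Prod>i\<in>I. f i / 40))\<^sup>2"
  by (induction I rule: infinite_finite_induct)
     (simp_all add: weight_def real_root_mult power_mult_distrib flip: times_divide_eq_left)

text \<open>A discrete form of the integral comparison for the series of j^(-4/3), obtained by
  factoring 1 = a^3 - b^3 for the two cube roots.\<close>

lemma inverse_cube_root_telescope:
  fixes x :: real
  assumes "x > 0"
  shows "1 / root 3 (x + 1) ^ 4 \<le> 3 * (1 / root 3 x - 1 / root 3 (x + 1))"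
proof -
  define a b where "a = root 3 (x + 1)" and "b = root 3 x"
  have b: "b > 0" "b \<le> a" and cubes: "a ^ 3 = x + 1" "b ^ 3 = x"
    using assms by (simp_all add: a_def b_def)
  have a: "a > 0" using b by linarith
  have "1 = (a - b) * (a\<^sup>2 + a * b + b\<^sup>2)"
    using cubes by (simp add: algebra_simps power2_eq_square power3_eq_cube)
  also have "\<dots> \<le> (a - b) * (3 * a\<^sup>2)"
  proof (rule mult_left_mono)
    have "a * b \<le> a\<^sup>2" "b\<^sup>2 \<le> a\<^sup>2"
      using a b by (simp_all add: power2_eq_square mult_mono)
    then show "a\<^sup>2 + a * b + b\<^sup>2 \<le> 3 * a\<^sup>2" by linarith
  qed (use b in simp)
  finally have "1 \<le> (a - b) * (3 * a\<^sup>2)" .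
  then have "b * 1 \<le> a * ((a - b) * (3 * a\<^sup>2))"
    using a b by (intro mult_mono) auto
  then have "1 / a ^ 4 \<le> 3 * (1 / b - 1 / a)"
    using a b(1) by (simp add: field_simps power2_eq_square power4_eq_xxxx)
  then show ?thesis by (simp add: a_def b_def)
qed

text \<open>The subtracted term bounds the remaining tail, which lets the induction close: for j >=
  2 the summand is at most 0.2242 j^(-4/3), and telescoping contributes the factor 3, hence
  0.6726.\<close>

lemma sum_weight_le:
  "(\<Sum>i\<le>n. 2 * weight (real i + 2) / (real i + 1)\<^sup>2) \<le> 19/20 - 6726/10000 / root 3 (real n + 1)"
proof (induction n)
  case 0
  \<comment> \<open>The fraction is a rational upper bound for the cube root of 1/20, about
    0.36840.\<close>
  have "root 3 (1/20 :: real) \<le> root 3 ((36841/100000) ^ 3)"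
    by (intro real_root_le_mono) (simp_all add: power3_eq_cube)
  then have "root 3 (1/20 :: real) \<le> 36841/100000"
    by (simp add: real_root_power_cancel)
  then have "(root 3 (1/20 :: real))\<^sup>2 \<le> (36841/100000)\<^sup>2"
    by (intro power_mono) simp_all
  then show ?case by (simp add: weight_def power2_eq_square)
next
  case (Suc n)
  define j where "j = real n + 2"
  have "j \<ge> 2" by (simp add: j_def)
  define a where "a = root 3 j"
  have "a > 0" and cube: "a ^ 3 = j" using \<open>j \<ge> 2\<close> by (simp_all add: a_def)
  \<comment> \<open>Since j >= 2, (j + 1)/40 is at most 0.0375 j, and 0.3348^3 is slightly above
    0.0375.\<close>
  have "root 3 ((j + 1) / 40) \<le> root 3 ((3348/10000) ^ 3 * j)"
    using \<open>j \<ge> 2\<close> by (intro real_root_le_mono) (simp_all add: power3_eq_cube)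
  also have "\<dots> = 3348/10000 * a"
    unfolding real_root_mult a_def by (simp add: real_root_power_cancel)
  finally have "weight (j + 1) \<le> (3348/10000 * a)\<^sup>2"
    unfolding weight_def using \<open>j \<ge> 2\<close> by (intro power_mono) simp_all
  also have "\<dots> \<le> 1121/10000 * a\<^sup>2"
    by (simp add: power_mult_distrib power2_eq_square)
  finally have "2 * weight (j + 1) / j\<^sup>2 \<le> 2 * (1121/10000 * a\<^sup>2) / j\<^sup>2"
    by (intro divide_right_mono mult_left_mono) simp_all
  also have "\<dots> = 2242/10000 * (1 / a ^ 4)"
    unfolding cube[symmetric] using \<open>a > 0\<close> by (simp add: field_simps flip: power_mult power_add)
  also have "\<dots> \<le> 2242/10000 * (3 * (1 / root 3 (real n + 1) - 1 / a))"
    using inverse_cube_root_telescope[of "real n + 1"]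
    by (intro mult_left_mono) (simp_all add: a_def j_def add.assoc)
  also have "\<dots> = 6726/10000 * (1 / root 3 (real n + 1)) - 6726/10000 * (1 / a)"
    unfolding right_diff_distrib by simp
  finally have "2 * weight (j + 1) / j\<^sup>2
      \<le> 6726/10000 * (1 / root 3 (real n + 1)) - 6726/10000 * (1 / a)" .
  moreover have "real (Suc n) + 2 = j + 1" "real (Suc n) + 1 = j"
    by (simp_all add: j_def)
  ultimately have "2 * weight (real (Suc n) + 2) / (real (Suc n) + 1)\<^sup>2
      \<le> 6726/10000 * (1 / root 3 (real n + 1)) - 6726/10000 * (1 / root 3 (real (Suc n) + 1))"
    by (simp only: a_def)
  with Suc show ?case unfolding sum.atMost_Suc by linarith
qed

section \<open>Inverse branches and their Jacobians\<close>

text \<open>With u = n + z$1, v = m + z$2 and d = u + v - 1, the sign 1 gives (v/d, u/d) and the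
  sign -1 gives (1 - v/d, 1 - u/d). Writing the latter as a reflection about 1/2 covers both cases
  by one formula.\<close>

definition inv_branch :: "real \<Rightarrow> real \<Rightarrow> real \<Rightarrow> real^2 \<Rightarrow> real^2" where
  "inv_branch \<sigma> n m z =
     (let d = n + m - 1 + z $ 1 + z $ 2 in
      vector [1/2 + \<sigma> * ((m + z $ 2) / d - 1/2), 1/2 + \<sigma> * ((n + z $ 1) / d - 1/2)])"

lemma inv_branch_nonneg:
  assumes "\<sigma> \<in> {1, -1}" "n \<ge> 1" "m \<ge> 1" "z $ 1 \<ge> 0" "z $ 2 \<ge> 0"
  shows "inv_branch \<sigma> n m z $ 1 \<ge> 0" "inv_branch \<sigma> n m z $ 2 \<ge> 0"
  using assms by (auto simp: inv_branch_def Let_def field_simps)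

definition inv_branch_deriv :: "real \<Rightarrow> real \<Rightarrow> real \<Rightarrow> real^2 \<Rightarrow> real^2 \<Rightarrow> real^2" where
  "inv_branch_deriv \<sigma> n m z h =
     (let u = n + z $ 1; v = m + z $ 2; d = n + m - 1 + z $ 1 + z $ 2 in
      vector [\<sigma> * (((u - 1) * h $ 2 - v * h $ 1) / d\<^sup>2), \<sigma> * (((v - 1) * h $ 1 - u * h $ 2) / d\<^sup>2)])"

lemma inv_branch_has_derivative:
  assumes "n + m - 1 + z $ 1 + z $ 2 \<noteq> 0"
  shows "(inv_branch \<sigma> n m has_derivative inv_branch_deriv \<sigma> n m z) (at z within S)"
proof -
  have nth: "((\<lambda>z::real^2. z $ i) has_derivative (\<lambda>h. h $ i)) (at z within S)" for i
    by (rule bounded_linear_imp_has_derivative[OF bounded_linear_vec_nth])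
  have 1: "((\<lambda>z. inv_branch \<sigma> n m z $ 1) has_derivative (\<lambda>h. inv_branch_deriv \<sigma> n m z h $ 1)) (at z within S)"
    unfolding inv_branch_def inv_branch_deriv_def Let_def vector_2
    by (rule derivative_eq_intros nth refl | use assms in \<open>simp; fail\<close>)+
       (use assms in \<open>auto simp: fun_eq_iff field_simps power2_eq_square\<close>)
  have 2: "((\<lambda>z. inv_branch \<sigma> n m z $ 2) has_derivative (\<lambda>h. inv_branch_deriv \<sigma> n m z h $ 2)) (at z within S)"
    unfolding inv_branch_def inv_branch_deriv_def Let_def vector_2
    by (rule derivative_eq_intros nth refl | use assms in \<open>simp; fail\<close>)+
       (use assms in \<open>auto simp: fun_eq_iff field_simps power2_eq_square\<close>)
  have "((\<lambda>z. inv_branch \<sigma> n m z $ i) has_derivative (\<lambda>h. inv_branch_deriv \<sigma> n m z h $ i)) (at z within S)" for i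
    using 1 2 exhaust_2[of i] by auto
  then show ?thesis
    by (subst has_derivative_componentwise_within) (auto simp: Basis_vec_def inner_axis)
qed

text \<open>The numerator of the determinant collapses to d, cancelling one of four powers of d; the
  sign enters only through its square.\<close>

lemma det_inv_branch_deriv:
  assumes "\<sigma> \<in> {1, -1}" "n + m - 1 + z $ 1 + z $ 2 \<noteq> 0"
  shows "det (matrix (inv_branch_deriv \<sigma> n m z)) = 1 / (n + m - 1 + z $ 1 + z $ 2) ^ 3"
proof -
  define u v d where "u = n + z $ 1" "v = m + z $ 2" "d = n + m - 1 + z $ 1 + z $ 2"
  have d: "d = u + v - 1" "d \<noteq> 0" using assms by (simp_all add: u_v_d_def)
  have "det (matrix (inv_branch_deriv \<sigma> n m z))
      = \<sigma>\<^sup>2 * ((v * u - (u - 1) * (v - 1)) / (d\<^sup>2 * d\<^sup>2))"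
    unfolding det_2 matrix_def inv_branch_deriv_def Let_def
    by (simp add: axis_def flip: u_v_d_def) (simp add: power2_eq_square algebra_simps diff_divide_distrib add_divide_distrib)
  also have "v * u - (u - 1) * (v - 1) = d" by (simp add: d algebra_simps)
  also have "\<sigma>\<^sup>2 * (d / (d\<^sup>2 * d\<^sup>2)) = 1 / d ^ 3"
    using assms(1) d(2) by (auto simp: power2_eq_square power3_eq_cube)
  finally show ?thesis by (simp add: u_v_d_def)
qed

text \<open>For nonnegative coordinates the denominator is at least n + m - 1, so the Jacobian has a
  uniform bound on \<open>S\<close>, which then bounds the measure of the image.\<close>

lemma
  assumes "\<sigma> \<in> {1, -1}" "n + m > 1" "S \<in> lmeasurable" "\<And>z. z \<in> S \<Longrightarrow> z $ 1 \<ge> 0 \<and> z $ 2 \<ge> 0"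
  shows inv_branch_image_lmeasurable: "inv_branch \<sigma> n m ` S \<in> lmeasurable"
    and measure_inv_branch_image_le:
      "measure lebesgue (inv_branch \<sigma> n m ` S) \<le> 1 / (n + m - 1) ^ 3 * measure lebesgue S"
proof -
  have pos: "0 < n + m - 1" "n + m - 1 \<le> n + m - 1 + z $ 1 + z $ 2" if "z \<in> S" for z
    using assms(2) assms(4)[OF that] by auto
  have deriv: "(inv_branch \<sigma> n m has_derivative inv_branch_deriv \<sigma> n m z) (at z within S)" if "z \<in> S" for z
    using pos[OF that] by (intro inv_branch_has_derivative) auto
  have bound: "\<bar>det (matrix (inv_branch_deriv \<sigma> n m z))\<bar> \<le> 1 / (n + m - 1) ^ 3" if "z \<in> S" for z
  proof -
    have "\<bar>det (matrix (inv_branch_deriv \<sigma> n m z))\<bar> = 1 / (n + m - 1 + z $ 1 + z $ 2) ^ 3"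
      using pos[OF that] assms(1) by (subst det_inv_branch_deriv) auto
    also have "\<dots> \<le> 1 / (n + m - 1) ^ 3"
      using pos[OF that] by (intro divide_left_mono power_mono mult_pos_pos) auto
    finally show ?thesis .
  qed
  have "(\<lambda>z. \<bar>det (matrix (inv_branch_deriv \<sigma> n m z))\<bar>) absolutely_integrable_on S"
  proof (rule measurable_bounded_by_integrable_imp_absolutely_integrable)
    have "continuous_on S (\<lambda>z. \<bar>1 / (n + m - 1 + z $ 1 + z $ 2) ^ 3\<bar>)"
      using pos by (intro continuous_intros) fastforce
    then have "continuous_on S (\<lambda>z. \<bar>det (matrix (inv_branch_deriv \<sigma> n m z))\<bar>)"
      by (rule continuous_on_eq) (use pos assms(1) in \<open>fastforce simp: det_inv_branch_deriv\<close>)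
    then show "(\<lambda>z. \<bar>det (matrix (inv_branch_deriv \<sigma> n m z))\<bar>) \<in> borel_measurable (lebesgue_on S)"
      using assms(3) by (intro continuous_imp_measurable_on_sets_lebesgue) auto
    show "(\<lambda>z. 1 / (n + m - 1) ^ 3) integrable_on S"
      using assms(3) by (rule integrable_on_const)
  qed (use bound assms(3) in auto)
  then have int: "(\<lambda>z. \<bar>det (matrix (inv_branch_deriv \<sigma> n m z))\<bar>) integrable_on S"
    by (rule set_lebesgue_integral_eq_integral)
  show "inv_branch \<sigma> n m ` S \<in> lmeasurable"
    "measure lebesgue (inv_branch \<sigma> n m ` S) \<le> 1 / (n + m - 1) ^ 3 * measure lebesgue S"
    using measurable_bounded_differentiable_image[OF assms(3) deriv int bound]
      measure_bounded_differentiable_image[OF assms(3) deriv int bound] by auto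
qed


section \<open>Measure of the sets with a large product of weights\<close>

text \<open>
  \<open>cyl k c\<close> contains the points whose first \<open>k\<close> digit pairs have weights with product at least \<open>c\<close>.
  A digit pair with \<open>n + m = i + 2\<close> is written \<open>(n' + 1, i - n' + 1)\<close> with \<open>n' \<le> i\<close>.
  The sets live in \<open>real^2\<close> because the change-of-variables theorems are stated there.
\<close>

primrec cyl :: "nat \<Rightarrow> real \<Rightarrow> (real^2) set" where
  "cyl 0 c = (if c \<le> 1 then cbox 0 1 else {})"
| "cyl (Suc k) c =
     (\<Union>i. \<Union>n\<in>{..i}. \<Union>\<sigma>\<in>{1, -1}.
       inv_branch \<sigma> (real n + 1) (real (i - n) + 1) ` cyl k (c / weight (real i + 2)))"

lemma cyl_nonneg: "z \<in> cyl k c \<Longrightarrow> z $ 1 \<ge> 0 \<and> z $ 2 \<ge> 0"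
proof (induction k arbitrary: z c)
  case 0
  then show ?case by (auto simp: mem_box_cart split: if_splits)
next
  case (Suc k)
  then obtain i n \<sigma> w where "\<sigma> \<in> {1, -1}" "w \<in> cyl k (c / weight (real i + 2))"
    "z = inv_branch \<sigma> (real n + 1) (real (i - n) + 1) w"
    unfolding cyl.simps by blast
  with Suc.IH show ?case by (auto intro!: inv_branch_nonneg)
qed

lemma cyl_antimono: "c \<le> c' \<Longrightarrow> cyl k c' \<subseteq> cyl k c"
proof (induction k arbitrary: c c')
  case (Suc k)
  have "cyl k (c' / weight (real i + 2)) \<subseteq> cyl k (c / weight (real i + 2))" for i
    using Suc by (intro Suc.IH divide_right_mono) (auto simp: weight_pos less_imp_le)
  then show ?case unfolding cyl.simps by (intro UN_mono image_mono) auto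
qed auto

text \<open>Markov's inequality by induction on the depth: dividing the level by a weight multiplies
  the bound by that weight, and summing over the first digit pair costs at most a factor
  19/20.\<close>

lemma cyl_measure:
  "c > 0 \<Longrightarrow> cyl k c \<in> lmeasurable \<and> measure lebesgue (cyl k c) \<le> (19/20) ^ k / c"
proof (induction k arbitrary: c)
  case 0
  have "measure lebesgue (cbox 0 1 :: (real^2) set) = 1"
    by (simp add: content_cbox_cart interval_eq_empty_cart)
  with 0 show ?case by simp
next
  case (Suc k)
  let ?w = "\<lambda>i. weight (real i + 2)"
  define B where "B = (19/20) ^ k / c"
  have "B \<ge> 0" using Suc.prems by (simp add: B_def)
  let ?S = "\<lambda>i. cyl k (c / ?w i)"
  have S: "?S i \<in> lmeasurable" "measure lebesgue (?S i) \<le> B * ?w i" for i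
    using Suc.IH[of "c / ?w i"] Suc.prems weight_pos[of "real i + 2"] by (auto simp: B_def)
  define A where "A i n \<sigma> = inv_branch \<sigma> (real n + 1) (real (i - n) + 1) ` ?S i" for i n \<sigma>
  have A: "A i n \<sigma> \<in> lmeasurable" "measure lebesgue (A i n \<sigma>) \<le> 1 / (real i + 1) ^ 3 * (B * ?w i)"
    if "n \<le> i" "\<sigma> \<in> {1, -1}" for i n \<sigma>
  proof -
    have sum: "real n + 1 + (real (i - n) + 1) - 1 = real i + 1" using that by simp
    show "A i n \<sigma> \<in> lmeasurable"
      unfolding A_def using that S cyl_nonneg by (intro inv_branch_image_lmeasurable) auto
    have "measure lebesgue (A i n \<sigma>) \<le> 1 / (real i + 1) ^ 3 * measure lebesgue (?S i)"
      unfolding A_def using that S cyl_nonneg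
      by (subst sum[symmetric], intro measure_inv_branch_image_le) auto
    also have "\<dots> \<le> 1 / (real i + 1) ^ 3 * (B * ?w i)"
      using S by (intro mult_left_mono) auto
    finally show "measure lebesgue (A i n \<sigma>) \<le> 1 / (real i + 1) ^ 3 * (B * ?w i)" .
  qed
  define U where "U i = (\<Union>n\<in>{..i}. \<Union>\<sigma>\<in>{1, -1}. A i n \<sigma>)" for i
  have A2: "(\<Union>\<sigma>\<in>{1, -1}. A i n \<sigma>) \<in> lmeasurable" if "n \<le> i" for i n
    using that A by (intro fmeasurable.finite_UN) auto
  have U: "U i \<in> lmeasurable" for i
    unfolding U_def by (intro fmeasurable.finite_UN A2) auto
  have U_le: "measure lebesgue (U i) \<le> B * (2 * ?w i / (real i + 1)\<^sup>2)" for i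
  proof -
    have "measure lebesgue (U i) \<le> (\<Sum>n\<le>i. measure lebesgue (\<Union>\<sigma>\<in>{1, -1}. A i n \<sigma>))"
      unfolding U_def using A2 by (intro measure_UNION_le) (auto simp: fmeasurableD)
    also have "\<dots> \<le> (\<Sum>n\<le>i. \<Sum>\<sigma>\<in>{1, -1}. measure lebesgue (A i n \<sigma>))"
      using A by (intro sum_mono measure_UNION_le) (auto simp: fmeasurableD)
    also have "\<dots> \<le> (\<Sum>n\<le>i. \<Sum>\<sigma>\<in>{1, -1 :: real}. 1 / (real i + 1) ^ 3 * (B * ?w i))"
      using A by (intro sum_mono) auto
    also have "\<dots> = B * (2 * ?w i / (real i + 1)\<^sup>2)"
    proof -
      define d where "d = real i + 1"
      have "d > 0" by (simp add: d_def)
      then have "d * (2 * (1 / d ^ 3 * (B * ?w i))) = B * (2 * ?w i / d\<^sup>2)"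
        by (simp add: power2_eq_square power3_eq_cube)
      then show ?thesis by (simp add: d_def add.commute)
    qed
    finally show ?thesis .
  qed
  \<comment> \<open>A bound uniform in \<open>n\<close> is what passes to the countable
    union.\<close>
  have fin: "measure lebesgue (\<Union>i\<le>n. U i) \<le> 19/20 * B" for n
  proof -
    have "measure lebesgue (\<Union>i\<le>n. U i) \<le> (\<Sum>i\<le>n. measure lebesgue (U i))"
      using U by (intro measure_UNION_le) (auto simp: fmeasurableD)
    also have "\<dots> \<le> (\<Sum>i\<le>n. B * (2 * ?w i / (real i + 1)\<^sup>2))"
      by (intro sum_mono U_le)
    also have "\<dots> \<le> B * (19/20)"
      unfolding sum_distrib_left[symmetric]
    proof (rule mult_left_mono[OF order_trans[OF sum_weight_le] \<open>B \<ge> 0\<close>])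
      show "19/20 - 6726/10000 / root 3 (real n + 1) \<le> 19/20" by simp
    qed
    finally show ?thesis by simp
  qed
  have "cyl (Suc k) c = (\<Union>i. U i)" by (simp add: U_def A_def)
  then show ?case
    using fmeasurable_countable_Union[OF U fin] measure_countable_Union_le[OF U fin]
    by (simp add: B_def)
qed

text \<open>The level stays fixed while the depth grows, so the bounds (19/20)^(r l)/c tend to
  0.\<close>

lemma negligible_cyl_limit:
  fixes r :: "nat \<Rightarrow> nat"
  assumes "c > 0" "strict_mono r"
  shows "negligible (\<Inter>l. cyl (r l) c)"
proof (subst negligible_outer_le, intro allI impI)
  fix e :: real assume "e > 0"
  have "(\<lambda>k. (19/20) ^ k / c) \<longlonglongrightarrow> 0 / c"
    by (intro tendsto_divide LIMSEQ_power_zero) (use assms in auto)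
  then have "(\<lambda>l. (19/20) ^ r l / c) \<longlonglongrightarrow> 0"
    using LIMSEQ_subseq_LIMSEQ[OF _ assms(2)] by (force simp: o_def)
  then have "\<forall>\<^sub>F l in sequentially. (19/20) ^ r l / c < e"
    using \<open>e > 0\<close> by (rule order_tendstoD)
  then obtain l where "(19/20) ^ r l / c < e"
    using eventually_happens by force
  then show "\<exists>T. (\<Inter>l. cyl (r l) c) \<subseteq> T \<and> T \<in> lmeasurable \<and> measure lebesgue T \<le> e"
    using cyl_measure[OF assms(1), of "r l"] by (intro exI[of _ "cyl (r l) c"]) auto
qed


section \<open>Orbits and their digits\<close>

abbreviation vec2 :: "real \<times> real \<Rightarrow> real^2" where
  "vec2 z \<equiv> vector [fst z, snd z]"

text \<open>With s = |x + y - 1| one has u + v - 1 = 1/s, so multiplying by s recovers the point.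
  Both u and v are at least 1 because s is at most each of their numerators.\<close>

lemma inv_branch_uv:
  assumes "0 \<le> x" "x < 1" "0 \<le> y" "y < 1" "x + y \<noteq> 1" "uv (x, y) = (u, v)"
  shows "u \<ge> 1" "v \<ge> 1"
    and "inv_branch (sgn (x + y - 1)) \<lfloor>u\<rfloor> \<lfloor>v\<rfloor> (vec2 (frac u, frac v)) = vec2 (x, y)"
proof -
  define \<sigma> where "\<sigma> = sgn (x + y - 1)"
  have *: "u \<ge> 1 \<and> v \<ge> 1 \<and> 1/2 + \<sigma> * (v / (u + v - 1) - 1/2) = x
      \<and> 1/2 + \<sigma> * (u / (u + v - 1) - 1/2) = y"
  proof (cases "x + y > 1")
    case True
    define s where "s = x + y - 1"
    have s: "s > 0" "u = y / s" "v = x / s" and "\<sigma> = 1"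
      using assms True by (auto simp: uv_def s_def \<sigma>_def)
    moreover have "u + v - 1 = 1 / s"
      using s by (simp add: field_simps) (simp add: s_def)
    moreover have "s \<le> y" "s \<le> x" using assms by (auto simp: s_def)
    ultimately show ?thesis by simp
  next
    case False
    define s where "s = 1 - (x + y)"
    have s: "s > 0" "u = (1 - y) / s" "v = (1 - x) / s" and "\<sigma> = -1"
      using assms False by (auto simp: uv_def s_def \<sigma>_def)
    moreover have "u + v - 1 = 1 / s"
      using s by (simp add: field_simps) (simp add: s_def)
    moreover have "s \<le> 1 - y" "s \<le> 1 - x" using assms by (auto simp: s_def)
    ultimately show ?thesis by simp
  qed
  then show "u \<ge> 1" "v \<ge> 1" by simp_all
  have eqs: "real_of_int \<lfloor>u\<rfloor> + real_of_int \<lfloor>v\<rfloor> - 1 + frac u + frac v = u + v - 1" "\<lfloor>u\<rfloor> + frac u = u" "\<lfloor>v\<rfloor> + frac v = v"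
    by (simp_all add: frac_def)
  show "inv_branch (sgn (x + y - 1)) \<lfloor>u\<rfloor> \<lfloor>v\<rfloor> (vec2 (frac u, frac v)) = vec2 (x, y)"
    unfolding inv_branch_def Let_def vector_2 fst_conv snd_conv eqs
    using * by (simp only: \<sigma>_def)
qed

text \<open>Here \<open>q\<close> is the point at which the preliminary procedure stops.\<close>

locale infinite_orbit =
  fixes q :: "real \<times> real"
  assumes q: "q \<in> D"
    and sum_neq_1: "fst (xy q k) + snd (xy q k) \<noteq> 1"
begin

text \<open>Truncated subtraction makes \<open>N 0\<close> repeat \<open>N 1\<close>; the products
  below start at index 1 or later.\<close>

definition N :: "nat \<Rightarrow> real" where
  "N k = digit_n q k + digit_m q k"

lemma xy_bounds:
  "0 \<le> fst (xy q k)" "fst (xy q k) < 1" "0 \<le> snd (xy q k)" "snd (xy q k) < 1"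
proof -
  have "0 \<le> fst (xy q k) \<and> fst (xy q k) < 1 \<and> 0 \<le> snd (xy q k) \<and> snd (xy q k) < 1"
  proof (cases k)
    case 0
    with q show ?thesis by (cases q) (auto simp: D_def field_simps)
  qed (simp add: frac_lt_1)
  then show "0 \<le> fst (xy q k)" "fst (xy q k) < 1" "0 \<le> snd (xy q k)" "snd (xy q k) < 1"
    by auto
qed

lemma xy_step:
  obtains \<sigma> where "\<sigma> \<in> {1, -1 :: real}" "digit_n q (Suc k) \<ge> 1" "digit_m q (Suc k) \<ge> 1"
    "vec2 (xy q k) = inv_branch \<sigma> (digit_n q (Suc k)) (digit_m q (Suc k)) (vec2 (xy q (Suc k)))"
proof -
  obtain x y where xy: "xy q k = (x, y)" by fastforce
  obtain u v where uv: "uv (x, y) = (u, v)" by fastforce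
  have hyps: "0 \<le> x" "x < 1" "0 \<le> y" "y < 1" "x + y \<noteq> 1"
    using xy_bounds[of k] sum_neq_1[of k] by (simp_all add: xy)
  note inv = inv_branch_uv[OF hyps uv]
  show thesis
  proof (rule that)
    show "sgn (x + y - 1) \<in> {1, -1}" using hyps by (auto simp: sgn_if)
  qed (use inv in \<open>simp_all add: digit_n_def digit_m_def xy uv\<close>)
qed

lemma digits_pos: "digit_n q (Suc k) \<ge> 1" "digit_m q (Suc k) \<ge> 1"
  by (rule xy_step[of k], simp)+

lemma N_pos: "k \<ge> 1 \<Longrightarrow> N k > 0"
  using digits_pos[of "k - 1"] by (simp add: N_def)

text \<open>The induction peels off the first digit pair, so the starting time \<open>i\<close> must
  vary.\<close>

lemma xy_mem_cyl: "vec2 (xy q i) \<in> cyl k (\<Prod>j=i+1..i+k. weight (N j))"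
proof (induction k arbitrary: i)
  case 0
  show ?case using xy_bounds[of i] by (auto simp: mem_box_cart forall_2)
next
  case (Suc k)
  obtain \<sigma> where \<sigma>: "\<sigma> \<in> {1, -1 :: real}" "digit_n q (Suc i) \<ge> 1" "digit_m q (Suc i) \<ge> 1"
    "vec2 (xy q i) = inv_branch \<sigma> (digit_n q (Suc i)) (digit_m q (Suc i)) (vec2 (xy q (Suc i)))"
    by (rule xy_step)
  \<comment> \<open>Shifting both digits down by one matches the indexing of \<open>cyl\<close>,
    with \<open>a + b\<close> as its index \<open>i\<close>.\<close>
  define a b where "a = nat (digit_n q (Suc i) - 1)" and "b = nat (digit_m q (Suc i) - 1)"
  have ab: "real_of_int (digit_n q (Suc i)) = real a + 1" "real_of_int (digit_m q (Suc i)) = real b + 1"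
    using \<sigma> by (simp_all add: a_def b_def)
  have N: "N (Suc i) = real (a + b) + 2" using ab by (simp add: N_def)
  have "(\<Prod>j=i+1..i+Suc k. weight (N j)) / weight (real (a + b) + 2) = (\<Prod>j=Suc i+1..Suc i+k. weight (N j))"
    using weight_pos[of "N (Suc i)"] by (simp add: prod.atLeast_Suc_atMost[of "Suc i"] N)
  with Suc.IH[of "Suc i"] have "vec2 (xy q (Suc i)) \<in>
      cyl k ((\<Prod>j=i+1..i+Suc k. weight (N j)) / weight (real (a + b) + 2))"
    by metis
  moreover have "vec2 (xy q i) = inv_branch \<sigma> (real a + 1) (real (a + b - a) + 1) (vec2 (xy q (Suc i)))"
    using \<sigma>(4) by (simp add: ab)
  moreover have "a \<in> {..a + b}" by simp
  ultimately show ?case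
    unfolding cyl.simps using \<sigma>(1) by blast
qed

text \<open>After the first \<open>K - s\<close> digits, the expansion is cut into consecutive
  windows of length \<open>s\<close>. Each contributes a factor at least 1, so the product never
  falls below its initial value \<open>c\<close> at the ends of windows.\<close>

lemma xy_mem_cyl_progression:
  assumes "s \<ge> 1" "K \<ge> s" "\<And>k. k \<ge> K \<Longrightarrow> (\<Prod>j = k - s + 1..k. N j) \<ge> 40 ^ s"
  obtains c where "c > 0" "\<And>l. vec2 (xy q 0) \<in> cyl (K - s + l * s) c"
proof -
  define c where "c = (\<Prod>j=1..K - s. weight (N j))"
  have "c > 0"
    unfolding c_def using weight_pos N_pos by (intro prod_pos) auto
  have le: "c \<le> (\<Prod>j=1..K - s + l * s. weight (N j))" for l
  proof (induction l)
    case (Suc l)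
    \<comment> \<open>The window ending at this \<open>k\<close> begins just after position
      \<open>K - s + l * s\<close>, so it extends the previous product exactly.\<close>
    define k where "k = K + l * s"
    have k: "k - s = K - s + l * s" "K - s + Suc l * s = k - s + s" "k - s + s = k"
      using assms(2) by (simp_all add: k_def)
    have "(\<Prod>j = k - s + 1..k. N j / 40) = (\<Prod>j = k - s + 1..k. N j) / 40 ^ s"
      using assms(2) by (simp add: prod_dividef k_def)
    then have "(\<Prod>j = k - s + 1..k. N j / 40) \<ge> 1"
      using assms(3)[of k] by (simp add: k_def)
    then have "root 3 (\<Prod>j = k - s + 1..k. N j / 40) \<ge> 1" by simp
    then have "(\<Prod>j = k - s + 1..k. weight (N j)) \<ge> 1"
      unfolding prod_weight by (rule one_le_power)
    with Suc \<open>c > 0\<close> have "c * 1 \<le> (\<Prod>j=1..k - s. weight (N j)) * (\<Prod>j = k - s + 1..k. weight (N j))"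
      unfolding k(1)[symmetric] by (intro mult_mono) auto
    also have "\<dots> = (\<Prod>j=1..K - s + Suc l * s. weight (N j))"
      unfolding k(2) by (subst prod.ub_add_nat) (simp_all add: k(3))
    finally show ?case by simp
  qed (simp add: c_def)
  show thesis
  proof (rule that[OF \<open>c > 0\<close>])
    show "vec2 (xy q 0) \<in> cyl (K - s + l * s) c" for l
      using xy_mem_cyl[of 0 "K - s + l * s"] cyl_antimono[OF le[of l]] by auto
  qed
qed

end

text \<open>The levels are restricted to \<open>1 / (M + 1)\<close> so that the union is countable.\<close>

definition exceptional :: "(real^2) set" where
  "exceptional = (\<Union>k. \<Union>s\<in>{1..}. \<Union>M. \<Inter>l. cyl (k + l * s) (1 / real (Suc M)))"

lemma negligible_exceptional: "negligible exceptional"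
  unfolding exceptional_def
  by (intro negligible_countable_Union countable_image)
     (auto intro!: negligible_countable_Union negligible_cyl_limit strict_monoI)

lemma (in infinite_orbit) xy_mem_exceptional:
  assumes "s \<ge> 1" "K \<ge> s" "\<And>k. k \<ge> K \<Longrightarrow> (\<Prod>j = k - s + 1..k. N j) \<ge> 40 ^ s"
  shows "vec2 (xy q 0) \<in> exceptional"
proof -
  obtain c where c: "c > 0" "\<And>l. vec2 (xy q 0) \<in> cyl (K - s + l * s) c"
    using xy_mem_cyl_progression[OF assms] by blast
  obtain M where "inverse (real (Suc M)) < c" using reals_Archimedean[OF c(1)] by blast
  then have "1 / real (Suc M) \<le> c" by (simp add: inverse_eq_divide)
  from cyl_antimono[OF this] c(2) have "vec2 (xy q 0) \<in> (\<Inter>l. cyl (K - s + l * s) (1 / real (Suc M)))"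
    by blast
  then show ?thesis unfolding exceptional_def using assms(1) by blast
qed

section \<open>Pulling null sets back to the parameter plane\<close>

lemma negligible_xy_0_vimage:
  assumes "negligible S"
  shows "negligible {q \<in> D. vec2 (xy q 0) \<in> S}"
proof (rule negligible_subset)
  \<comment> \<open>This inverts the initial change of coordinates: 2 - y = 1/(1 - \<alpha>), 1 - y
    = \<alpha>/(1 - \<alpha>) and 1 - x = \<beta>/(1 - \<alpha>). It also passes from
    \<open>real^2\<close> to pairs.\<close>
  let ?f = "\<lambda>z::real^2. ((1 - z $ 2) / (2 - z $ 2), (1 - z $ 1) / (2 - z $ 2))"
  let ?S = "S \<inter> {z. z $ 2 < 2}"
  show "negligible (?f ` ?S)"
  proof (rule negligible_differentiable_image_negligible)
    have nth: "(\<lambda>z::real^2. z $ i) differentiable (at z within ?S)" for i z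
      by (rule bounded_linear_imp_differentiable[OF bounded_linear_vec_nth])
    show "?f differentiable_on ?S"
      unfolding differentiable_on_def
      by (auto intro!: differentiable_Pair differentiable_divide differentiable_diff nth)
  qed (use assms in \<open>auto intro: negligible_subset\<close>)
  show "{q \<in> D. vec2 (xy q 0) \<in> S} \<subseteq> ?f ` ?S"
  proof
    fix q assume *: "q \<in> {q \<in> D. vec2 (xy q 0) \<in> S}"
    obtain \<alpha> \<beta> where q: "q = (\<alpha>, \<beta>)" by fastforce
    have "\<alpha> < 1/2" using * by (simp add: q D_def)
    then have "q = ?f (vec2 (xy q 0))" "vec2 (xy q 0) $ 2 < 2"
      by (simp_all add: q field_simps)
    then show "q \<in> ?f ` ?S" using * by blast
  qed
qed

text \<open>Undoing one step is a differentiable map, which preserves null sets, and a stopping run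
  has finitely many steps; a countable union over their number suffices.\<close>

lemma negligible_stops_at_vimage:
  assumes "negligible Z"
  shows "negligible {p. \<exists>q\<in>Z. stops_at p q}"
proof (rule negligible_subset)
  \<comment> \<open>This is the inverse of \<open>F\<close>, as 2 - (2\<alpha> - 1)/\<alpha> =
    1/\<alpha>. The map \<open>G\<close> is its own inverse.\<close>
  let ?f = "\<lambda>z :: real \<times> real. (1 / (2 - fst z), snd z / (2 - fst z))"
  define P where "P = rec_nat Z (\<lambda>_ A. A \<union> ?f ` (A \<inter> {z. fst z < 2}) \<union> G ` A)"
  have P: "P 0 = Z" "P (Suc k) = P k \<union> ?f ` (P k \<inter> {z. fst z < 2}) \<union> G ` P k" for k
    by (simp_all add: P_def)
  have fst: "(fst :: real \<times> real \<Rightarrow> real) differentiable (at z within S)"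
    and snd: "(snd :: real \<times> real \<Rightarrow> real) differentiable (at z within S)" for z S
    by (rule bounded_linear_imp_differentiable bounded_linear_fst bounded_linear_snd)+
  have "negligible (P k)" for k
  proof (induction k)
    case (Suc k)
    have "negligible (?f ` (P k \<inter> {z. fst z < 2}))"
    proof (rule negligible_differentiable_image_negligible)
      show "?f differentiable_on (P k \<inter> {z. fst z < 2})"
        unfolding differentiable_on_def
        by (auto intro!: differentiable_Pair differentiable_divide differentiable_diff fst snd)
    qed (use Suc in \<open>auto intro: negligible_subset\<close>)
    moreover have "negligible (G ` P k)"
    proof (rule negligible_differentiable_image_negligible)
      show "G differentiable_on P k"
        unfolding differentiable_on_def G_def case_prod_beta
        by (auto intro!: differentiable_Pair differentiable_diff fst snd)
    qed (use Suc in auto)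
    ultimately show ?case unfolding P using Suc by simp
  qed (simp add: P assms)
  then show "negligible (\<Union>k. P k)" by blast
  show "{p. \<exists>q\<in>Z. stops_at p q} \<subseteq> (\<Union>k. P k)"
  proof clarify
    fix p q assume "stops_at p q" "q \<in> Z"
    then show "p \<in> (\<Union>k. P k)"
    proof (induction rule: stops_at.induct)
      case (stop p)
      then show ?case using P(1) by blast
    next
      case (apply_F \<alpha> \<beta> q)
      then obtain k where "F (\<alpha>, \<beta>) \<in> P k" by blast
      moreover have "(\<alpha>, \<beta>) = ?f (F (\<alpha>, \<beta>))" "fst (F (\<alpha>, \<beta>)) < 2"
        using apply_F.hyps by (simp_all add: F_def field_simps)
      ultimately have "(\<alpha>, \<beta>) \<in> P (Suc k)" unfolding P by blast
      then show ?case by blast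
    next
      case (apply_G \<alpha> \<beta> q)
      then obtain k where "G (\<alpha>, \<beta>) \<in> P k" by blast
      moreover have "(\<alpha>, \<beta>) = G (G (\<alpha>, \<beta>))" by (simp add: G_def)
      ultimately have "(\<alpha>, \<beta>) \<in> P (Suc k)" unfolding P by blast
      then show ?case by blast
    qed
  qed
qed

theorem corollary1:
  fixes C0 :: real
  assumes "C0 \<ge> 20"
  shows "{p \<in> D0. \<exists>n m \<epsilon>. infinite_expansion p n m \<epsilon> \<and>
            (\<exists>s\<ge>1. \<exists>K\<ge>s. \<forall>k\<ge>K.
               (\<Prod>j = k - s + 1..k. real_of_int (n j + m j)) \<ge> (2 * C0) ^ s)}
         \<in> null_sets (lebesgue :: (real \<times> real) measure)"
    (is "?P \<in> _")
proof -
  let ?Z = "{q \<in> D. vec2 (xy q 0) \<in> exceptional}"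
  have "?P \<subseteq> {p. \<exists>q\<in>?Z. stops_at p q}"
  proof safe
    fix \<alpha> \<beta> n m \<epsilon> s K
    assume "infinite_expansion (\<alpha>, \<beta>) n m \<epsilon>" and s: "1 \<le> s" "s \<le> K"
      and large: "\<forall>k\<ge>K. (\<Prod>j = k - s + 1..k. real_of_int (n j + m j)) \<ge> (2 * C0) ^ s"
    then obtain q where stops: "stops_at (\<alpha>, \<beta>) q" and "\<And>k. fst (xy q k) + snd (xy q k) \<noteq> 1"
      and digits: "\<And>k. k \<ge> 1 \<Longrightarrow> n k = digit_n q k \<and> m k = digit_m q k"
      unfolding infinite_expansion_def by blast
    have "q \<in> D" using stops by (induction rule: stops_at.induct)
    interpret infinite_orbit q by unfold_locales fact+
    have "vec2 (xy q 0) \<in> exceptional"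
    proof (rule xy_mem_exceptional[OF s])
      fix k assume "K \<le> k"
      \<comment> \<open>The constant \<open>C0\<close> enters only here, through 40 <= 2
        \<open>C0\<close>.\<close>
      have "40 ^ s \<le> (2 * C0) ^ s" using assms by (intro power_mono) auto
      also have "\<dots> \<le> (\<Prod>j = k - s + 1..k. real_of_int (n j + m j))"
        using large \<open>K \<le> k\<close> by blast
      \<comment> \<open>Every index in the window is at least 1, where the given digits agree with
        those computed from \<open>q\<close>.\<close>
      also have "\<dots> = (\<Prod>j = k - s + 1..k. N j)"
        by (intro prod.cong refl) (simp add: N_def digits)
      finally show "40 ^ s \<le> (\<Prod>j = k - s + 1..k. N j)" .
    qed
    with \<open>q \<in> D\<close> stops show "\<exists>q\<in>?Z. stops_at (\<alpha>, \<beta>) q" by blast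
  qed
  moreover have "negligible {p. \<exists>q\<in>?Z. stops_at p q}"
    by (intro negligible_stops_at_vimage negligible_xy_0_vimage negligible_exceptional)
  ultimately show ?thesis
    unfolding negligible_iff_null_sets[symmetric] by (rule negligible_subset[rotated])
qed

end
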